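(* Suppose that each $f_i$ is $L$-smooth on $\Omega$ ($L>0$), i.e. $\|\nabla f_i(x)-\nabla f_i(y)\|\le L\|x-y\|$ for all $x,y\in\Omega$; that $f$ is $\mu$-strongly convex on $\Omega$ ($\mu>0$), i.e. $f(y)\ge f(x)+\langle y-x,\nabla f(x)\rangle+\frac\mu2\|y-x\|^2$ for all $x,y\in\Omega$; that $\mathcal G$ and $W$ are as in the context; and that there is a constant $R_s>0$ with $\|\mathbf{x}(t)-\mathbf{x}_*\|^2\le R_s$ for all $t\ge0$. If the stepsize is a constant $\alpha(t)\equiv\alpha>0$ with $\alpha\le\frac{2}{L+\mu}$, then for all $t\ge1$ $$\|\bar{\mathbf{x}}(t)-\mathbf{x}_*\|^2\le\Big(1-\frac{\mu\alpha}{2}\Big)^t\|\bar{\mathbf{x}}(0)-\mathbf{x}_*\|^2+G_1\Big(\Big(1-\frac{\mu\alpha}{2}\Big)^{t-1}+\beta^{\frac{t-1}{2}}\Big)+G_2\,\alpha,$$ where $$G_1=\frac{2(c_3\alpha^2+c_4\alpha+\beta)R_s}{\mu\alpha},\qquad G_2=\frac2\mu\Big((c_3\alpha^2+c_4\alpha+\beta)\frac{3(L^2R_s+nR_D^* )}{(1-\beta)^2}+c_1R_s+c_2\Big),$$ and $c_1=\frac{3L^2}{1-\beta}$, $c_2=\frac{3nR_D^*}{1-\beta}$, $c_3=c_1+L^2$, $c_4=\frac{4L^2}{\mu}$.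
   Context: Let $n,d\ge1$, let $\Omega\subset\mathbb{R}^d$ be a nonempty closed convex set, $f_i:\Omega\to\mathbb{R}$ ($1\le i\le n$) differentiable functions, and $f=\frac1n\sum_{i=1}^n f_i$. $\|\cdot\|$ is the Euclidean norm and $\mathcal{P}_\Omega[y]=\arg\min_{x\in\Omega}\|x-y\|$. $x_*$ denotes the unique minimizer of $f$ over $\Omega$, and $R_D^*:=\max_{1\le i\le n}\|\nabla f_i(x_* )\|^2$. Network: $\mathcal{G}=(\mathcal V,\mathcal E)$, $\mathcal V=\{1,\dots,n\}$, is a fixed (time-independent) connected undirected graph. The mixing matrix $W=[w_{ij}]$ has nonnegative entries, with $w_{ij}\ne0$ if $\{i,j\}\in\mathcal E$ and, for $i\neq j$, $w_{ij}=0$ if $\{i,j\}\notin\mathcal E$; $W$ is symmetric and doubly stochastic, $w_{ii}>0$ for all $i$, and $\mathrm{null}(I-W)=\mathrm{span}\{(1,\dots,1)^T\}$. $\beta\in[0,1)$ is the second largest magnitude of the eigenvalues of $W$. Decentralized projected gradient (DPG) iterates: given $x_i(0)\in\Omega$ and stepsizes $\alpha(t)>0$, $$x_i(t+1)=\mathcal{P}_\Omega\Big[\sum_{j=1}^n w_{ij}x_j(t)-\alpha(t)\nabla f_i(x_i(t))\Big],\qquad 1\le i\le n,\ t\ge0.$$ Put $\bar x(t)=\frac1n\sum_i x_i(t)$, $\mathbf{x}(t)=(x_1(t),\dots,x_n(t))$, $\bar{\mathbf{x}}(t)=(\bar x(t),\dots,\bar x(t))$, $\mathbf{x}_*=(x_*,\dots,x_*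 )$ in $\mathbb{R}^{dn}$. *)

theory Defs
  imports "HOL-Analysis.Analysis" "HOL-Library.Multiset"
begin

definition average :: "('n::finite \<Rightarrow> 'b::real_vector) \<Rightarrow> 'b" where
  "average v = (1 / real CARD('n)) *\<^sub>R (\<Sum>i\<in>UNIV. v i)"

text \<open>
  A point of the product space \<open>\<real>\<^sup>d\<^sup>n\<close> is an element of \<open>(real ^ 'd) ^ 'n\<close>; its library norm is the
  Euclidean norm of the concatenated vector.
\<close>

definition stack_avg :: "(real ^ 'd) ^ 'n \<Rightarrow> (real ^ 'd) ^ 'n" where
  "stack_avg x = vec (average (\<lambda>i. x $ i))"

text \<open>
  The derivative is taken relative to \<open>\<Omega>\<close>, since \<open>f\<close> is only given there. If the convex set \<open>\<Omega>\<close> has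
  nonempty interior then \<open>g\<close> is determined on \<open>\<Omega>\<close> by \<open>f\<close>; otherwise \<open>g\<close> may be any selection of
  gradients.
\<close>

definition gradient_on :: "(real ^ 'd) set \<Rightarrow> (real ^ 'd \<Rightarrow> real) \<Rightarrow> (real ^ 'd \<Rightarrow> real ^ 'd) \<Rightarrow> bool" where
  "gradient_on \<Omega> f g \<longleftrightarrow> (\<forall>x\<in>\<Omega>. (f has_derivative (\<lambda>h. h \<bullet> g x)) (at x within \<Omega>))"

definition strongly_convex_on ::
  "real \<Rightarrow> (real ^ 'd) set \<Rightarrow> (real ^ 'd \<Rightarrow> real) \<Rightarrow> (real ^ 'd \<Rightarrow> real ^ 'd) \<Rightarrow> bool" where
  "strongly_convex_on \<mu> \<Omega> f g \<longleftrightarrow>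
     (\<forall>x\<in>\<Omega>. \<forall>y\<in>\<Omega>. f y \<ge> f x + (y - x) \<bullet> g x + \<mu> / 2 * (norm (y - x))\<^sup>2)"

definition connected_graph :: "'n set set \<Rightarrow> bool" where
  "connected_graph E \<longleftrightarrow> (\<forall>e\<in>E. card e = 2) \<and> (\<forall>i j. (i, j) \<in> {(u, v). {u, v} \<in> E}\<^sup>*)"

definition mixing_matrix :: "'n set set \<Rightarrow> real ^ 'n ^ 'n \<Rightarrow> bool" where
  "mixing_matrix E W \<longleftrightarrow>
     (\<forall>i j. W $ i $ j \<ge> 0) \<and>
     (\<forall>i j. {i, j} \<in> E \<longrightarrow> W $ i $ j \<noteq> 0) \<and>
     (\<forall>i j. i \<noteq> j \<and> {i, j} \<notin> E \<longrightarrow> W $ i $ j = 0) \<and>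
     transpose W = W \<and>
     (\<forall>i. (\<Sum>j\<in>UNIV. W $ i $ j) = 1) \<and>
     (\<forall>j. (\<Sum>i\<in>UNIV. W $ i $ j) = 1) \<and>
     (\<forall>i. W $ i $ i > 0) \<and>
     {v. (mat 1 - W) *v v = 0} = span {vec 1}"

definition eigenspace :: "real ^ 'n ^ 'n \<Rightarrow> real \<Rightarrow> (real ^ 'n) set" where
  "eigenspace W l = {v. W *v v = l *\<^sub>R v}"

text \<open>
  Eigenvalues repeated according to the dimension of the eigenspace. This is only meant for symmetric
  matrices, whose eigenvalues are all real with equal geometric and algebraic multiplicity.
\<close>

definition eigenvalue_mset :: "real ^ 'n ^ 'n \<Rightarrow> real multiset" where
  "eigenvalue_mset W =
     (\<Sum>l\<in>{l. \<exists>v\<in>eigenspace W l. v \<noteq> 0}. replicate_mset (dim (eigenspace W l)) l)"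

text \<open>The index set of the sum is finite, so the sum does not degenerate to \<open>{#}\<close>:\<close>

lemma finite_eigenvalues:
  fixes W :: "real ^ 'n ^ 'n"
  assumes sym: "transpose W = W"
  shows "finite {l. \<exists>v\<in>eigenspace W l. v \<noteq> 0}"
proof -
  define S where "S = {l. \<exists>v\<in>eigenspace W l. v \<noteq> 0}"
  define e where "e l = (SOME v. v \<in> eigenspace W l \<and> v \<noteq> 0)" for l
  have e: "W *v e l = l *\<^sub>R e l \<and> e l \<noteq> 0" if "l \<in> S" for l
  proof -
    have "\<exists>v. v \<in> eigenspace W l \<and> v \<noteq> 0"
      using that by (auto simp: S_def)
    then have "e l \<in> eigenspace W l \<and> e l \<noteq> 0"
      unfolding e_def by (rule someI_ex)
    then show ?thesis by (simp add: eigenspace_def)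
  qed
  have orth: "e l \<bullet> e m = 0" if "l \<in> S" "m \<in> S" "l \<noteq> m" for l m
  proof -
    have "(W *v e l) \<bullet> e m = e l \<bullet> (W *v e m)"
      by (metis dot_lmul_matrix sym transpose_matrix_vector)
    then have "l * (e l \<bullet> e m) = m * (e l \<bullet> e m)"
      using e[OF that(1)] e[OF that(2)] by simp
    then show ?thesis using that(3) by simp
  qed
  have inj: "inj_on e S"
    by (metis e orth inj_onI inner_eq_zero_iff)
  have "pairwise orthogonal (e ` S)"
    by (force simp: pairwise_def orthogonal_def intro: orth)
  moreover have "0 \<notin> e ` S" using e by force
  ultimately have "finite (e ` S)"
    using independent_imp_finite pairwise_orthogonal_independent by blast
  then show ?thesis
    using inj finite_imageD S_def by blast
qed

text \<open>
  Eigenvalues are counted with multiplicity. A \<open>1 \<times> 1\<close> matrix has no second eigenvalue; the value is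
  then \<open>0\<close> by convention.
\<close>

definition second_eigenvalue_magnitude :: "real ^ 'n ^ 'n \<Rightarrow> real" where
  "second_eigenvalue_magnitude W =
     (let M = image_mset abs (eigenvalue_mset W);
          M' = M - {#Max_mset M#}
      in if M' = {#} then 0 else Max_mset M')"

definition dpg_iterates ::
  "(real ^ 'd) set \<Rightarrow> real ^ 'n ^ 'n \<Rightarrow> ('n \<Rightarrow> real ^ 'd \<Rightarrow> real ^ 'd) \<Rightarrow> (nat \<Rightarrow> real)
    \<Rightarrow> (nat \<Rightarrow> (real ^ 'd) ^ 'n) \<Rightarrow> bool" where
  "dpg_iterates \<Omega> W g \<alpha> x \<longleftrightarrow>
     (\<forall>i. x 0 $ i \<in> \<Omega>) \<and>
     (\<forall>t i. x (Suc t) $ i =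
        closest_point \<Omega> ((\<Sum>j\<in>UNIV. W $ i $ j *\<^sub>R x t $ j) - \<alpha> t *\<^sub>R g i (x t $ i)))"

end

theory Submission
  imports Defs
begin

text \<open>
  Stack the states of the agents into one vector \<open>x\<close>, and split the error \<open>x - vec x_star\<close>
  orthogonally into the optimality error \<open>a = (norm (stack_avg x - vec x_star))\<^sup>2\<close> of the average
  and the disagreement \<open>b = (norm (x - stack_avg x))\<^sup>2\<close>. One iteration first forms
  \<open>y = W x - \<alpha> G\<close>, where \<open>G\<close> stacks the local gradients, and then projects each component.

  The minimizer is the projection of \<open>z = x_star - \<alpha> \<nabla>f(x_star)\<close>. Comparing \<open>y\<close> with \<open>vec z\<close> and
  with its own average, nonexpansiveness of the projection and Pythagoras give
  (\<open>projected_step_le\<close>)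
  \<open>b' \<le> (norm (y - stack_avg y))\<^sup>2\<close> and
  \<open>a' \<le> (norm (stack_avg y - vec z))\<^sup>2 + (norm (y - stack_avg y))\<^sup>2\<close>.

  The spread of \<open>y\<close> is governed by the network: \<open>W\<close> shrinks vectors with sum zero by the factor \<open>\<beta>\<close>, so
  the spread is at most \<open>\<beta> b + \<alpha>\<^sup>2 (norm G)\<^sup>2 / (1 - \<beta>)\<close> (\<open>disagreement_after_step_le\<close>), and
  \<open>norm G\<close> is bounded because the iterates are. The distance of the averages is governed by
  \<open>f\<close>: strong convexity contracts it, the gradients being evaluated at the
  \<open>x\<^sub>i\<close> instead of at their average costs a multiple of \<open>b\<close>, and the second order term is at most
  \<open>\<alpha>\<^sup>2 L\<^sup>2 R_s\<close> (\<open>gradient_step_contraction\<close>). This second order term fits into the \<open>O(\<alpha>)\<close> part of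
  the claimed bound, because after summation it is divided by \<open>\<mu> \<alpha> / 2\<close>.

  The result is a triangular pair of linear recursions for \<open>a\<close> and \<open>b\<close> with rates
  \<open>r = 1 - \<mu> \<alpha> / 2\<close> and \<open>\<beta>\<close>. Unrolling it produces the convolution
  \<open>\<Sum>k\<le>m. r ^ (m - k) * \<beta> ^ k\<close>, which \<open>mixed_geometric_sum_le\<close> bounds by
  \<open>(r ^ m + sqrt \<beta> ^ m) / (1 - r)\<close>.
\<close>

section \<open>Spectrum of the mixing matrix\<close>

text \<open>
  The norm of \<open>A v\<close> is maximal over the compact unit sphere of \<open>S\<close> at some \<open>v\<close>, with value \<open>M\<close>.
  Expanding the square shows \<open>A (A v) = M\<^sup>2 v\<close>. Now \<open>A\<^sup>2 - M\<^sup>2\<close> factors as \<open>(A - M) (A + M)\<close>: either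
  \<open>A v + M v\<close> vanishes and \<open>v\<close> is an eigenvector for \<open>- M\<close>, or it is one for \<open>M\<close>.
\<close>

lemma symmetric_matrix_norm_attained_at_eigenvector:
  fixes A :: "real ^ 'n ^ 'n"
  assumes sym: "transpose A = A"
    and S: "subspace S" "\<And>v. v \<in> S \<Longrightarrow> A *v v \<in> S" "S \<noteq> {0}"
  shows "\<exists>l. \<exists>u\<in>S. u \<noteq> 0 \<and> A *v u = l *\<^sub>R u \<and> (\<forall>v\<in>S. norm (A *v v) \<le> \<bar>l\<bar> * norm v)"
proof -
  have self: "(A *v u) \<bullet> v = u \<bullet> (A *v v)" for u v
    by (metis dot_lmul_matrix sym transpose_matrix_vector)
  have "compact (S \<inter> sphere 0 1)"
    using closed_subspace[OF S(1)] by (simp add: closed_Int_compact)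
  moreover obtain a where a: "a \<in> S" "a \<noteq> 0"
    using S(1,3) subspace_0 by blast
  then have "a /\<^sub>R norm a \<in> S \<inter> sphere 0 1"
    using S(1) by (simp add: subspace_scale)
  then have "S \<inter> sphere 0 1 \<noteq> {}" by blast
  moreover have "continuous_on (S \<inter> sphere 0 1) (\<lambda>v. norm (A *v v))"
    by (intro continuous_intros linear_continuous_on matrix_vector_mul_bounded_linear)
  ultimately obtain v where v: "v \<in> S \<inter> sphere 0 1"
      and max: "\<And>w. w \<in> S \<inter> sphere 0 1 \<Longrightarrow> norm (A *v w) \<le> norm (A *v v)"
    using continuous_attains_sup by metis
  define M where "M = norm (A *v v)"
  have bound: "norm (A *v w) \<le> M * norm w" if "w \<in> S" for w
  proof (cases "w = 0")
    case False
    have "w /\<^sub>R norm w \<in> S \<inter> sphere 0 1"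
      using False that S(1) by (simp add: subspace_scale)
    then have "norm (A *v (w /\<^sub>R norm w)) \<le> M"
      unfolding M_def by (rule max)
    then show ?thesis
      using False by (simp add: matrix_vector_mult_scaleR field_simps)
  qed simp
  have vv: "v \<bullet> v = 1" using v by (simp add: norm_eq_1)
  have "norm (A *v (A *v v)) \<le> M * M"
    using bound[of "A *v v"] v S(2) by (simp add: M_def)
  then have le: "(norm (A *v (A *v v)))\<^sup>2 \<le> (M * M)\<^sup>2"
    by (intro power_mono) auto
  have "(A *v (A *v v)) \<bullet> v = M\<^sup>2"
    unfolding M_def by (simp add: self power2_norm_eq_inner)
  then have "(norm (A *v (A *v v) - M\<^sup>2 *\<^sub>R v))\<^sup>2 = (norm (A *v (A *v v)))\<^sup>2 - (M * M)\<^sup>2"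
    unfolding power2_norm_eq_inner
    by (simp add: inner_diff inner_commute[of v "A *v (A *v v)"] vv)
      (simp add: power2_eq_square power4_eq_xxxx)
  with le have "(norm (A *v (A *v v) - M\<^sup>2 *\<^sub>R v))\<^sup>2 \<le> 0" by linarith
  then have AAv: "A *v (A *v v) = M\<^sup>2 *\<^sub>R v" by simp
  have M0: "M \<ge> 0" by (simp add: M_def)
  show ?thesis
  proof (cases "A *v v + M *\<^sub>R v = 0")
    case True
    then have "A *v v = (- M) *\<^sub>R v"
      by (simp add: eq_neg_iff_add_eq_0)
    moreover have "v \<noteq> 0" using vv by auto
    ultimately show ?thesis
      using v bound M0 by (intro exI[of _ "- M"] bexI[of _ v]) auto
  next
    case False
    have "A *v (A *v v + M *\<^sub>R v) = M *\<^sub>R (A *v v + M *\<^sub>R v)"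
      by (simp add: matrix_vector_right_distrib matrix_vector_mult_scaleR AAv scaleR_add_right
          power2_eq_square)
    moreover have "A *v v + M *\<^sub>R v \<in> S"
      using v S by (simp add: subspace_add subspace_scale)
    ultimately show ?thesis
      using False bound M0 by (intro exI[of _ M] bexI[of _ "A *v v + M *\<^sub>R v"]) auto
  qed
qed

text \<open>
  Gershgorin's argument at the largest entry of the eigenvector. The eigenvalue lies within
  \<open>1 - W $ i $ i\<close> of the positive number \<open>W $ i $ i\<close>; positivity of the diagonal excludes \<open>- 1\<close>.
\<close>

lemma mixing_matrix_eigenvalue_bounds:
  fixes W :: "real ^ 'n ^ 'n"
  assumes W: "mixing_matrix E W" and v: "v \<in> eigenspace W l" "v \<noteq> 0"
  shows "- 1 < l" "l \<le> 1"
proof -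
  obtain i where i: "\<And>j. \<bar>v $ j\<bar> \<le> \<bar>v $ i\<bar>"
  proof -
    have "finite (range (\<lambda>j. \<bar>v $ j\<bar>))" by simp
    then have "Max (range (\<lambda>j. \<bar>v $ j\<bar>)) \<in> range (\<lambda>j. \<bar>v $ j\<bar>)"
      by (intro Max_in) auto
    then obtain i where "Max (range (\<lambda>j. \<bar>v $ j\<bar>)) = \<bar>v $ i\<bar>" by blast
    then show thesis
      using that[of i] by (metis Max_ge \<open>finite (range (\<lambda>j. \<bar>v $ j\<bar>))\<close> rangeI)
  qed
  have pos: "\<bar>v $ i\<bar> > 0"
  proof (rule ccontr)
    assume "\<not> \<bar>v $ i\<bar> > 0"
    then have "v $ j = 0" for j using i[of j] by simp
    with v(2) show False by (simp add: vec_eq_iff)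
  qed
  have W0: "W $ i $ j \<ge> 0" and Wii: "W $ i $ i > 0" and row: "(\<Sum>j\<in>UNIV. W $ i $ j) = 1" for j
    using W by (auto simp: mixing_matrix_def)
  have "l * v $ i = (\<Sum>j\<in>UNIV. W $ i $ j * v $ j)"
    using v(1) by (simp add: eigenspace_def vec_eq_iff matrix_vector_mult_def)
  also have "\<dots> = W $ i $ i * v $ i + (\<Sum>j\<in>UNIV - {i}. W $ i $ j * v $ j)"
    by (subst sum.remove[of UNIV i]) auto
  finally have "(l - W $ i $ i) * v $ i = (\<Sum>j\<in>UNIV - {i}. W $ i $ j * v $ j)"
    by (simp add: algebra_simps)
  then have "\<bar>l - W $ i $ i\<bar> * \<bar>v $ i\<bar> = \<bar>\<Sum>j\<in>UNIV - {i}. W $ i $ j * v $ j\<bar>"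
    by (metis abs_mult)
  also have "\<dots> \<le> (\<Sum>j\<in>UNIV - {i}. \<bar>W $ i $ j * v $ j\<bar>)"
    by (rule sum_abs)
  also have "\<dots> \<le> (\<Sum>j\<in>UNIV - {i}. W $ i $ j * \<bar>v $ i\<bar>)"
    by (intro sum_mono) (simp add: abs_mult W0 i mult_left_mono)
  also have "\<dots> = (1 - W $ i $ i) * \<bar>v $ i\<bar>"
    using row by (subst (asm) sum.remove[of UNIV i]) (auto simp: sum_distrib_right[symmetric])
  finally have "\<bar>l - W $ i $ i\<bar> \<le> 1 - W $ i $ i"
    using pos by simp
  then show "- 1 < l" "l \<le> 1" using Wii by auto
qed

lemma eigenspace_1_mixing_matrix:
  fixes W :: "real ^ 'n ^ 'n"
  assumes "mixing_matrix E W"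
  shows "eigenspace W 1 = span {vec 1}"
proof -
  have "eigenspace W 1 = {v. (mat 1 - W) *v v = 0}"
    by (auto simp: eigenspace_def matrix_vector_mult_diff_rdistrib)
  then show ?thesis using assms by (simp add: mixing_matrix_def)
qed

lemma count_eigenvalue_mset:
  fixes W :: "real ^ 'n ^ 'n"
  assumes "transpose W = W"
  shows "count (eigenvalue_mset W) l = dim (eigenspace W l)"
proof -
  let ?S = "{l. \<exists>v\<in>eigenspace W l. v \<noteq> 0}"
  have "count (eigenvalue_mset W) l = (\<Sum>k\<in>?S. if l = k then dim (eigenspace W k) else 0)"
    by (simp add: eigenvalue_mset_def count_sum)
  also have "\<dots> = (if l \<in> ?S then dim (eigenspace W l) else 0)"
    using finite_eigenvalues[OF assms] by (rule sum.delta')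
  also have "\<dots> = dim (eigenspace W l)"
    by (auto simp: dim_eq_0)
  finally show ?thesis .
qed

lemma set_eigenvalue_mset:
  fixes W :: "real ^ 'n ^ 'n"
  assumes "transpose W = W"
  shows "l \<in># eigenvalue_mset W \<longleftrightarrow> (\<exists>v\<in>eigenspace W l. v \<noteq> 0)"
proof -
  have "l \<in># eigenvalue_mset W \<longleftrightarrow> dim (eigenspace W l) \<noteq> 0"
    by (metis count_eigenvalue_mset[OF assms] not_in_iff)
  then show ?thesis unfolding dim_eq_0 by blast
qed

text \<open>
  The eigenvalue \<open>1\<close> is simple and no other eigenvalue has absolute value \<open>1\<close>. Removing one
  occurrence of the maximal absolute value therefore removes the eigenvalue \<open>1\<close> and nothing else.
\<close>

lemma abs_eigenvalues_without_max:
  fixes W :: "real ^ 'n ^ 'n"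
  assumes W: "mixing_matrix E W"
  defines "M \<equiv> image_mset abs (eigenvalue_mset W)"
  shows "y \<in># M - {#Max_mset M#} \<longleftrightarrow> (\<exists>l. l \<noteq> 1 \<and> y = \<bar>l\<bar> \<and> (\<exists>v\<in>eigenspace W l. v \<noteq> 0))"
proof -
  have sym: "transpose W = W" using W by (simp add: mixing_matrix_def)
  note eig = set_eigenvalue_mset[OF sym] and bounds = mixing_matrix_eigenvalue_bounds[OF W]
  have one: "1 \<in># eigenvalue_mset W"
  proof -
    have "(vec 1 :: real ^ 'n) \<noteq> 0" by (simp add: vec_eq_iff)
    then show ?thesis
      unfolding eig eigenspace_1_mixing_matrix[OF W] by (meson insertI1 span_base)
  qed
  have abs1: "\<bar>l\<bar> = 1 \<longleftrightarrow> l = 1" if "l \<in># eigenvalue_mset W" for l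
  proof -
    have "- 1 < l" using that bounds unfolding eig by blast
    then show ?thesis by linarith
  qed
  have abs_le: "\<bar>l\<bar> \<le> 1" if "l \<in># eigenvalue_mset W" for l
  proof -
    have "- 1 < l" "l \<le> 1" using that bounds unfolding eig by blast+
    then show ?thesis by linarith
  qed
  have "Max_mset M = 1"
  proof (rule Max_eqI)
    show "y \<le> 1" if "y \<in># M" for y using that abs_le by (auto simp: M_def)
    show "1 \<in># M" using one by (force simp: M_def)
  qed simp
  moreover have "count M 1 = 1"
  proof -
    have "count M 1 = (\<Sum>l\<in>{l \<in> set_mset (eigenvalue_mset W). \<bar>l\<bar> = 1}. count (eigenvalue_mset W) l)"
      unfolding M_def count_image_mset by (rule sum.cong) auto
    also have "{l \<in> set_mset (eigenvalue_mset W). \<bar>l\<bar> = 1} = {1}"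
      using abs1 one by auto
    also have "(\<Sum>l\<in>{1}. count (eigenvalue_mset W) l) = dim (span {vec 1 :: real ^ 'n})"
      by (simp add: count_eigenvalue_mset[OF sym] eigenspace_1_mixing_matrix[OF W])
    also have "\<dots> = 1"
      by (simp add: dim_singleton vec_eq_iff)
    finally show ?thesis .
  qed
  ultimately have "y \<in># M - {#Max_mset M#} \<longleftrightarrow> y \<in># M \<and> y \<noteq> 1"
    by (cases "y = 1") (auto simp: in_diff_count)
  also have "\<dots> \<longleftrightarrow> (\<exists>l. l \<noteq> 1 \<and> y = \<bar>l\<bar> \<and> l \<in># eigenvalue_mset W)"
    using abs1 by (auto simp: M_def)
  finally show ?thesis by (simp add: eig)
qed

lemma second_eigenvalue_magnitude_bounds:
  fixes W :: "real ^ 'n ^ 'n"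
  assumes W: "mixing_matrix E W"
  shows "0 \<le> second_eigenvalue_magnitude W" "second_eigenvalue_magnitude W < 1"
proof -
  define M where "M = image_mset abs (eigenvalue_mset W)"
  define M' where "M' = M - {#Max_mset M#}"
  have y: "0 \<le> y \<and> y < 1" if "y \<in># M'" for y
  proof -
    obtain l where "l \<noteq> 1" "y = \<bar>l\<bar>" "\<exists>v\<in>eigenspace W l. v \<noteq> 0"
      using \<open>y \<in># M'\<close> abs_eigenvalues_without_max[OF W] unfolding M'_def M_def by blast
    then show ?thesis
      using mixing_matrix_eigenvalue_bounds[OF W] by fastforce
  qed
  have "second_eigenvalue_magnitude W = (if M' = {#} then 0 else Max_mset M')"
    by (simp add: second_eigenvalue_magnitude_def Let_def M_def M'_def)
  moreover have "Max_mset M' \<in># M'" if "M' \<noteq> {#}" using that by simp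
  ultimately show "0 \<le> second_eigenvalue_magnitude W" "second_eigenvalue_magnitude W < 1"
    using y by (auto split: if_splits)
qed

text \<open>
  The vectors with sum zero form the orthogonal complement of \<open>vec 1\<close>, which \<open>W\<close> leaves invariant.
  The eigenvalue that attains the norm there is not \<open>1\<close>, because every eigenvector for \<open>1\<close> is a multiple
  of \<open>vec 1\<close>.
\<close>

lemma norm_mixing_matrix_le:
  fixes W :: "real ^ 'n ^ 'n"
  assumes W: "mixing_matrix E W" and v: "(\<Sum>i\<in>UNIV. v $ i) = 0"
  shows "norm (W *v v) \<le> second_eigenvalue_magnitude W * norm v"
proof -
  define S where "S = {v :: real ^ 'n. v \<bullet> vec 1 = 0}"
  have S_iff: "v \<in> S \<longleftrightarrow> (\<Sum>i\<in>UNIV. v $ i) = 0" for v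
    by (simp add: S_def inner_vec_def)
  have sym: "transpose W = W" using W by (simp add: mixing_matrix_def)
  have "W *v vec 1 = vec 1"
    using W by (simp add: mixing_matrix_def vec_eq_iff matrix_vector_mult_def)
  then have inv: "W *v v \<in> S" if "v \<in> S" for v
    using that unfolding S_def
    by (metis (mono_tags, lifting) dot_lmul_matrix mem_Collect_eq sym transpose_matrix_vector)
  have sub: "subspace S"
    by (auto simp: S_def subspace_def inner_add_left)
  show ?thesis
  proof (cases "S = {0}")
    case True
    then have "v = 0" using v S_iff by blast
    then show ?thesis by simp
  next
    case False
    then obtain l u where u: "u \<in> S" "u \<noteq> 0" "W *v u = l *\<^sub>R u"
        and bound: "\<And>v. v \<in> S \<Longrightarrow> norm (W *v v) \<le> \<bar>l\<bar> * norm v"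
      using symmetric_matrix_norm_attained_at_eigenvector[OF sym sub inv] by blast
    have "l \<noteq> 1"
    proof
      assume "l = 1"
      then have "u \<in> span {vec 1}"
        using u eigenspace_1_mixing_matrix[OF W] by (auto simp: eigenspace_def)
      then obtain c where c: "u = c *\<^sub>R vec 1"
        by (auto simp: span_singleton)
      with u(1) have "c = 0" by (simp add: S_iff)
      with c u(2) show False by simp
    qed
    with u have l: "\<bar>l\<bar> \<in># (let M = image_mset abs (eigenvalue_mset W) in M - {#Max_mset M#})"
      unfolding Let_def abs_eigenvalues_without_max[OF W] by (auto simp: eigenspace_def)
    then have "\<bar>l\<bar> \<le> second_eigenvalue_magnitude W"
      by (auto simp: second_eigenvalue_magnitude_def Let_def)
    then show ?thesis
      using bound[of v] v by (meson S_iff mult_right_mono norm_ge_zero order_trans)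
  qed
qed

section \<open>Coupled linear recursions\<close>

text \<open>
  The closed form of the sum degenerates when \<open>r\<close> and \<open>s\<^sup>2\<close> are close, so the terms are compared with
  those of the geometric series of \<open>r\<close>. If \<open>s \<le> r\<close>, then \<open>s\<^sup>2 \<le> r\<^sup>2\<close> and the sum is at most
  \<open>r ^ m * (\<Sum>k\<le>m. r ^ k)\<close>. If \<open>r < s\<close>, write \<open>s = r powr \<theta>\<close> with \<open>0 \<le> \<theta> \<le> 1\<close>. After division by
  \<open>s ^ m\<close> the exponent of \<open>r\<close> in the term with index \<open>k\<close> is \<open>(1 - \<theta>) * (m - k) + \<theta> * k\<close>, so convexity
  of the exponential bounds the term by \<open>(1 - \<theta>) * r ^ (m - k) + \<theta> * r ^ k\<close>. Both
  parts sum to the same geometric series, and the weights add up to \<open>1\<close>.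
\<close>

lemma mixed_geometric_sum_le:
  fixes r s :: real
  assumes r: "0 < r" "r < 1" and s: "0 \<le> s" "s \<le> 1"
  shows "(1 - r) * (\<Sum>k\<le>m. r ^ (m - k) * (s\<^sup>2) ^ k) \<le> r ^ m + s ^ m"
proof (cases "s \<le> r")
  case True
  have "(\<Sum>k\<le>m. r ^ (m - k) * (s\<^sup>2) ^ k) \<le> (\<Sum>k\<le>m. r ^ m * r ^ k)"
  proof (rule sum_mono)
    fix k assume "k \<in> {..m}"
    then have "r ^ m * r ^ k = r ^ (m - k) * (r\<^sup>2) ^ k"
      by (simp add: add.commute flip: power_add power_mult)
    then show "r ^ (m - k) * (s\<^sup>2) ^ k \<le> r ^ m * r ^ k"
      using True r s by (simp add: mult_left_mono power_mono)
  qed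
  then have "(1 - r) * (\<Sum>k\<le>m. r ^ (m - k) * (s\<^sup>2) ^ k) \<le> (1 - r) * (\<Sum>k\<le>m. r ^ m * r ^ k)"
    using r by (intro mult_left_mono) auto
  also have "\<dots> = r ^ m * (1 - r ^ Suc m)"
    unfolding sum_distrib_left[symmetric] using sum_gp_basic[of r m] by (simp add: mult.left_commute)
  also have "\<dots> \<le> r ^ m * 1" using r by (intro mult_left_mono) auto
  also have "\<dots> \<le> r ^ m + s ^ m" using s by simp
  finally show ?thesis .
next
  case False
  then have s0: "s > 0" and rs: "r < s" using r by auto
  define \<theta> where "\<theta> = ln s / ln r"
  have \<theta>: "0 \<le> \<theta>" "\<theta> \<le> 1"
    using r s s0 rs by (auto simp: \<theta>_def divide_simps)
  have s_eq: "s = exp (\<theta> * ln r)" using r s0 by (simp add: \<theta>_def)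
  have r_pow: "r ^ k = exp (real k * ln r)" for k
    using r by (simp add: exp_of_nat_mult)
  have s_pow: "s ^ k = exp (real k * \<theta> * ln r)" for k
    by (simp add: s_eq exp_of_nat_mult mult.assoc)
  have s2_pow: "(s\<^sup>2) ^ k = exp (2 * real k * \<theta> * ln r)" for k
    using s_pow[of "2 * k"] by (simp add: power_mult)
  have term_le: "r ^ (m - k) * (s\<^sup>2) ^ k \<le> s ^ m * ((1 - \<theta>) * r ^ (m - k) + \<theta> * r ^ k)"
    if "k \<le> m" for k
  proof -
    have "r ^ (m - k) * (s\<^sup>2) ^ k
        = s ^ m * exp ((1 - \<theta>) * (real (m - k) * ln r) + \<theta> * (real k * ln r))"
      using that unfolding s2_pow unfolding r_pow s_pow exp_add[symmetric]
      by (simp add: algebra_simps of_nat_diff)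
    also have "exp ((1 - \<theta>) * (real (m - k) * ln r) + \<theta> * (real k * ln r))
        \<le> (1 - \<theta>) * r ^ (m - k) + \<theta> * r ^ k"
      using convex_onD[OF exp_convex, of \<theta> "real (m - k) * ln r" "real k * ln r"] \<theta>
      by (simp add: r_pow)
    finally show ?thesis using s0 by simp
  qed
  have "(\<Sum>k\<le>m. r ^ (m - k) * (s\<^sup>2) ^ k)
      \<le> (\<Sum>k\<le>m. s ^ m * ((1 - \<theta>) * r ^ (m - k) + \<theta> * r ^ k))"
    by (intro sum_mono term_le) auto
  also have "\<dots> = s ^ m * ((1 - \<theta>) * (\<Sum>k\<le>m. r ^ (m - k)) + \<theta> * (\<Sum>k\<le>m. r ^ k))"
    by (simp add: sum.distrib flip: sum_distrib_left)
  also have "(\<Sum>k\<le>m. r ^ (m - k)) = (\<Sum>k\<le>m. r ^ k)"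
    using sum.nat_diff_reindex[of "\<lambda>k. r ^ k" "Suc m"] by (simp flip: lessThan_Suc_atMost)
  finally have "(1 - r) * (\<Sum>k\<le>m. r ^ (m - k) * (s\<^sup>2) ^ k) \<le> (1 - r) * (s ^ m * (\<Sum>k\<le>m. r ^ k))"
    using r by (intro mult_left_mono) (auto simp: algebra_simps)
  also have "\<dots> = s ^ m * (1 - r ^ Suc m)"
    using sum_gp_basic[of r m] by (simp add: mult.left_commute)
  also have "\<dots> \<le> s ^ m * 1" using r s0 by (intro mult_left_mono) auto
  also have "\<dots> \<le> r ^ m + s ^ m" using r by simp
  finally show ?thesis .
qed


lemma coupled_recursion_bound:
  fixes a b :: "nat \<Rightarrow> real"
  assumes a: "\<And>t. a (Suc t) \<le> r * a t + K * b t + D"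
    and b: "\<And>t. b (Suc t) \<le> \<beta> * b t + q"
    and r: "0 < r" "r < 1" and \<beta>: "0 \<le> \<beta>" "\<beta> < 1"
    and nonneg: "K \<ge> 0" "b 0 \<ge> 0" "q \<ge> 0" "D \<ge> 0"
  shows "a (Suc m) \<le> r ^ Suc m * a 0 + K * b 0 * ((r ^ m + sqrt \<beta> ^ m) / (1 - r))
    + (K * (q / (1 - \<beta>)) + D) / (1 - r)"
proof -
  define h where "h t = (\<Sum>k<t. r ^ (t - 1 - k) * \<beta> ^ k)" for t
  define C where "C = K * (q / (1 - \<beta>)) + D"
  \<comment> \<open>The forcing term \<open>K * \<beta> ^ k * b 0\<close> at time \<open>k\<close> is damped by \<open>r\<close> in each of the
    \<open>t - 1 - k\<close> later steps; \<open>h t\<close> collects these contributions.\<close>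
  have h_Suc: "h (Suc t) = r * h t + \<beta> ^ t" for t
  proof -
    have "(\<Sum>k<t. r ^ (t - k) * \<beta> ^ k) = r * h t"
      unfolding h_def sum_distrib_left
    proof (rule sum.cong)
      fix k assume "k \<in> {..<t}"
      then have "t - k = Suc (t - 1 - k)" by auto
      then show "r ^ (t - k) * \<beta> ^ k = r * (r ^ (t - 1 - k) * \<beta> ^ k)" by simp
    qed simp
    then show ?thesis by (simp add: h_def)
  qed
  have b_le: "b t \<le> \<beta> ^ t * b 0 + q / (1 - \<beta>)" for t
  proof (induction t)
    case 0
    then show ?case using nonneg \<beta> by simp
  next
    case (Suc t)
    have "b (Suc t) \<le> \<beta> * (\<beta> ^ t * b 0 + q / (1 - \<beta>)) + q"
      using b[of t] mult_left_mono[OF Suc \<beta>(1)] by linarith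
    also have "\<dots> = \<beta> ^ Suc t * b 0 + q / (1 - \<beta>)"
      using \<beta> by (simp add: field_simps)
    finally show ?case .
  qed
  have "a t \<le> r ^ t * a 0 + K * b 0 * h t + (1 - r ^ t) * (C / (1 - r))" for t
  proof (induction t)
    case 0
    then show ?case by (simp add: h_def)
  next
    case (Suc t)
    have "a (Suc t) \<le> r * (r ^ t * a 0 + K * b 0 * h t + (1 - r ^ t) * (C / (1 - r)))
        + K * (\<beta> ^ t * b 0 + q / (1 - \<beta>)) + D"
      using a[of t] mult_left_mono[OF Suc, of r] mult_left_mono[OF b_le[of t] nonneg(1)] r by linarith
    also have "\<dots> = r ^ Suc t * a 0 + K * b 0 * h (Suc t) + ((r - r ^ Suc t) * (C / (1 - r)) + C)"
      by (simp add: h_Suc C_def algebra_simps)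
    also have "(r - r ^ Suc t) * (C / (1 - r)) + C = (1 - r ^ Suc t) * (C / (1 - r))"
      using r by (simp add: field_simps)
    finally show ?case .
  qed
  from this[of "Suc m"]
  have "a (Suc m) \<le> r ^ Suc m * a 0 + K * b 0 * h (Suc m) + (1 - r ^ Suc m) * (C / (1 - r))" .
  also have "h (Suc m) \<le> (r ^ m + sqrt \<beta> ^ m) / (1 - r)"
    using mixed_geometric_sum_le[OF r, of "sqrt \<beta>" m] \<beta> r
    by (simp add: h_def field_simps lessThan_Suc_atMost del: sum.lessThan_Suc)
  also have "(1 - r ^ Suc m) * (C / (1 - r)) \<le> 1 * (C / (1 - r))"
    using r \<beta> nonneg by (intro mult_right_mono) (auto simp: C_def)
  finally show ?thesis
    using nonneg by (simp add: C_def mult_left_mono)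
qed

section \<open>Averages of stacked vectors\<close>

text \<open>The action of \<open>W\<close> tensored with the identity of \<open>real ^ 'd\<close>.\<close>

definition mix :: "real ^ 'n ^ 'n \<Rightarrow> (real ^ 'd) ^ 'n \<Rightarrow> (real ^ 'd) ^ 'n" where
  "mix W v = (\<chi> i. \<Sum>j\<in>UNIV. W $ i $ j *\<^sub>R v $ j)"

definition componentwise :: "('n \<Rightarrow> real ^ 'd \<Rightarrow> real ^ 'd) \<Rightarrow> (real ^ 'd) ^ 'n \<Rightarrow> (real ^ 'd) ^ 'n" where
  "componentwise h x = (\<chi> i. h i (x $ i))"

lemma power2_norm_stack: "(norm v)\<^sup>2 = (\<Sum>i\<in>UNIV. (norm (v $ i))\<^sup>2)"
  for v :: "'a::real_normed_vector ^ 'n"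
  by (simp add: norm_vec_def L2_set_def sum_nonneg)

lemma norm_stack_mono:
  fixes u v :: "'a::real_normed_vector ^ 'n"
  assumes "\<And>i. norm (u $ i) \<le> C * norm (v $ i)" and "C \<ge> 0"
  shows "norm u \<le> C * norm v"
proof (rule power2_le_imp_le)
  have "(norm u)\<^sup>2 \<le> (\<Sum>i\<in>UNIV. (C * norm (v $ i))\<^sup>2)"
    unfolding power2_norm_stack[of u] by (intro sum_mono power_mono assms) auto
  then show "(norm u)\<^sup>2 \<le> (C * norm v)\<^sup>2"
    by (simp add: power_mult_distrib power2_norm_stack[of v] sum_distrib_left)
qed (simp add: assms)

lemma norm_vec_stack: "(norm (vec c :: (real ^ 'd) ^ 'n))\<^sup>2 = real CARD('n) * (norm c)\<^sup>2"
  by (simp add: power2_norm_stack)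

text \<open>
  Both squared norms are sums over the coordinates of \<open>real ^ 'd\<close>, and \<open>W\<close> acts on each
  coordinate separately.
\<close>

lemma norm_mix_le:
  fixes v :: "(real ^ 'd) ^ 'n"
  assumes W: "mixing_matrix E W" and v: "(\<Sum>i\<in>UNIV. v $ i) = 0"
  shows "norm (mix W v) \<le> second_eigenvalue_magnitude W * norm v"
proof -
  let ?\<beta> = "second_eigenvalue_magnitude W"
  let ?col = "\<lambda>k. \<chi> i. v $ i $ k"
  note \<beta> = second_eigenvalue_magnitude_bounds[OF W]
  have sq: "(norm u)\<^sup>2 = (\<Sum>k\<in>UNIV. (norm (\<chi> i. u $ i $ k))\<^sup>2)" for u :: "(real ^ 'd) ^ 'n"
    by (simp add: power2_norm_stack) (rule sum.swap)
  have col: "(\<chi> i. mix W v $ i $ k) = W *v ?col k" for k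
    by (simp add: vec_eq_iff mix_def matrix_vector_mult_def)
  have "norm (W *v ?col k) \<le> ?\<beta> * norm (?col k)" for k
  proof (rule norm_mixing_matrix_le[OF W])
    have "(\<Sum>i\<in>UNIV. v $ i) $ k = 0" by (simp add: v)
    then show "(\<Sum>i\<in>UNIV. ?col k $ i) = 0" by simp
  qed
  then have "(\<Sum>k\<in>UNIV. (norm (W *v ?col k))\<^sup>2) \<le> (\<Sum>k\<in>UNIV. (?\<beta> * norm (?col k))\<^sup>2)"
    by (intro sum_mono power_mono) auto
  then have "(norm (mix W v))\<^sup>2 \<le> (?\<beta> * norm v)\<^sup>2"
    by (simp add: sq[of v] sq[of "mix W v"] col power_mult_distrib sum_distrib_left)
  then show ?thesis
    by (rule power2_le_imp_le) (simp add: \<beta>)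
qed

lemma average_simps:
  fixes u v :: "'n::finite \<Rightarrow> 'a::real_vector"
  shows "average (\<lambda>i. u i + v i) = average u + average v"
    "average (\<lambda>i. u i - v i) = average u - average v"
    "average (\<lambda>i. c *\<^sub>R v i) = c *\<^sub>R average v"
    "average (\<lambda>i :: 'n. a) = a"
  by (simp_all add: average_def sum.distrib sum_subtractf scaleR_add_right scaleR_diff_right
      sum_constant_scaleR mult.commute flip: scaleR_sum_right del: sum_constant)

lemma stack_avg_simps:
  fixes u v :: "(real ^ 'd) ^ 'n"
  shows "stack_avg (u + v) = stack_avg u + stack_avg v"
    "stack_avg (u - v) = stack_avg u - stack_avg v"
    "stack_avg (c *\<^sub>R v) = c *\<^sub>R stack_avg v"
    "stack_avg (vec a) = (vec a :: (real ^ 'd) ^ 'n)"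
    "stack_avg (stack_avg v) = stack_avg v"
  by (simp_all add: stack_avg_def vec_eq_iff average_simps)

lemma sum_minus_stack_avg:
  fixes v :: "(real ^ 'd) ^ 'n"
  shows "(\<Sum>i\<in>UNIV. (v - stack_avg v) $ i) = 0"
  by (simp add: stack_avg_def average_def sum_subtractf sum_constant_scaleR del: sum_constant)

lemma inner_vec_stack: "v \<bullet> vec c = (\<Sum>i\<in>UNIV. v $ i) \<bullet> c"
  for v :: "(real ^ 'd) ^ 'n"
  unfolding inner_vec_def[of v] by (simp add: inner_sum_left)

text \<open>
  Pythagoras: the deviation from the average has sum zero and is therefore orthogonal to every
  constant stack.
\<close>

lemma norm_minus_vec_stack:
  fixes v :: "(real ^ 'd) ^ 'n"
  shows "(norm (v - vec c))\<^sup>2 = (norm (v - stack_avg v))\<^sup>2 + (norm (stack_avg v - vec c))\<^sup>2"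
proof -
  have "stack_avg v - vec c = vec (average (($) v) - c)"
    by (simp add: stack_avg_def vec_eq_iff)
  then have "orthogonal (v - stack_avg v) (stack_avg v - vec c)"
    by (simp only: inner_vec_stack sum_minus_stack_avg orthogonal_def inner_zero_left)
  from norm_add_Pythagorean[OF this] show ?thesis by simp
qed

lemma norm_stack_avg_le: "norm (stack_avg v) \<le> norm v"
  and norm_minus_stack_avg_le: "norm (v - stack_avg v) \<le> norm v"
  for v :: "(real ^ 'd) ^ 'n"
proof -
  have "(vec 0 :: (real ^ 'd) ^ 'n) = 0" by (simp add: vec_eq_iff)
  then have "(norm v)\<^sup>2 = (norm (v - stack_avg v))\<^sup>2 + (norm (stack_avg v))\<^sup>2"
    using norm_minus_vec_stack[of v 0] by simp
  then have "(norm (stack_avg v))\<^sup>2 \<le> (norm v)\<^sup>2" "(norm (v - stack_avg v))\<^sup>2 \<le> (norm v)\<^sup>2"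
    by simp_all
  then show "norm (stack_avg v) \<le> norm v" "norm (v - stack_avg v) \<le> norm v"
    by (simp_all only: norm_ge_zero power_mono_iff zero_less_numeral)
qed

lemma stack_avg_mix:
  fixes v :: "(real ^ 'd) ^ 'n"
  assumes "mixing_matrix E W"
  shows "stack_avg (mix W v) = stack_avg v" "mix W (stack_avg v) = stack_avg v"
proof -
  have col: "(\<Sum>i\<in>UNIV. W $ i $ j) = 1" and row: "(\<Sum>i\<in>UNIV. W $ j $ i) = 1" for j
    using assms by (auto simp: mixing_matrix_def)
  have "(\<Sum>i\<in>UNIV. mix W v $ i) = (\<Sum>j\<in>UNIV. \<Sum>i\<in>UNIV. W $ i $ j *\<^sub>R v $ j)"
    by (simp add: mix_def) (rule sum.swap)
  then show "stack_avg (mix W v) = stack_avg v"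
    by (simp add: stack_avg_def average_def col flip: scaleR_left.sum)
  show "mix W (stack_avg v) = stack_avg v"
    by (simp add: mix_def stack_avg_def vec_eq_iff row flip: scaleR_left.sum sum_distrib_right)
qed

lemma mix_diff: "mix W (u - v) = mix W u - mix W v"
  by (simp add: mix_def vec_eq_iff algebra_simps sum_subtractf)

section \<open>The spread after a gradient step\<close>

text \<open>
  Convexity of the square at \<open>p * a + (1 - p) * (b / (1 - p))\<close>. This form stays valid for \<open>p = 0\<close>,
  where the usual Young inequality with parameter \<open>(1 - p) / p\<close> breaks down.
\<close>

lemma square_add_le_weighted:
  fixes a b p :: real
  assumes "0 \<le> p" "p < 1"
  shows "(p * a + b)\<^sup>2 \<le> p * a\<^sup>2 + b\<^sup>2 / (1 - p)"
proof -
  have "p * a\<^sup>2 + b\<^sup>2 / (1 - p) - (p * a + b)\<^sup>2 = p / (1 - p) * ((1 - p) * a - b)\<^sup>2"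
    using assms by (simp add: divide_simps) (simp add: power2_eq_square algebra_simps)
  also have "\<dots> \<ge> 0" using assms by simp
  finally show ?thesis by simp
qed

text \<open>
  Mixing fixes constant stacks and preserves averages, so it acts on the deviation from the average,
  where \<open>W\<close> contracts by \<open>\<beta>\<close>.
\<close>

lemma disagreement_after_step_le:
  fixes x G :: "(real ^ 'd) ^ 'n"
  assumes W: "mixing_matrix E W" and \<alpha>: "\<alpha> \<ge> 0"
  defines "\<beta> \<equiv> second_eigenvalue_magnitude W"
    and "y \<equiv> mix W x - \<alpha> *\<^sub>R G"
  shows "(norm (y - stack_avg y))\<^sup>2
      \<le> \<beta> * (norm (x - stack_avg x))\<^sup>2 + \<alpha>\<^sup>2 * (norm G)\<^sup>2 / (1 - \<beta>)"
proof -
  note \<beta> = second_eigenvalue_magnitude_bounds[OF W, folded \<beta>_def]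
  have "y - stack_avg y = mix W (x - stack_avg x) - \<alpha> *\<^sub>R (G - stack_avg G)"
    by (simp add: y_def stack_avg_simps stack_avg_mix[OF W] mix_diff algebra_simps)
  also have "norm \<dots> \<le> norm (mix W (x - stack_avg x)) + \<alpha> * norm (G - stack_avg G)"
    using norm_triangle_ineq4 \<alpha> by (metis abs_of_nonneg norm_scaleR)
  also have "\<dots> \<le> \<beta> * norm (x - stack_avg x) + \<alpha> * norm G"
    unfolding \<beta>_def using \<alpha>
    by (intro add_mono mult_left_mono norm_mix_le[OF W] sum_minus_stack_avg norm_minus_stack_avg_le)
  finally have "(norm (y - stack_avg y))\<^sup>2 \<le> (\<beta> * norm (x - stack_avg x) + \<alpha> * norm G)\<^sup>2"
    by (intro power_mono) auto
  also have "\<dots> \<le> \<beta> * (norm (x - stack_avg x))\<^sup>2 + (\<alpha> * norm G)\<^sup>2 / (1 - \<beta>)"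
    using \<beta> by (rule square_add_le_weighted)
  finally show ?thesis by (simp add: power_mult_distrib)
qed

section \<open>Progress of the average\<close>

text \<open>
  Adding the strong convexity inequalities for \<open>(u, v)\<close> and \<open>(v, u)\<close> cancels the function values and
  leaves strong monotonicity of the averaged gradient.
\<close>

lemma strongly_monotone_average:
  fixes g :: "'n::finite \<Rightarrow> real ^ 'd \<Rightarrow> real ^ 'd"
  assumes "strongly_convex_on \<mu> \<Omega> h (\<lambda>y. average (\<lambda>i. g i y))" "u \<in> \<Omega>" "v \<in> \<Omega>"
  shows "(vec u - vec v) \<bullet> stack_avg (componentwise g (vec u) - componentwise g (vec v))
      \<ge> \<mu> * (norm (vec u - vec v :: (real ^ 'd) ^ 'n))\<^sup>2"
proof -
  let ?g = "\<lambda>y. average (\<lambda>i. g i y)"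
  have "h u \<ge> h v + (u - v) \<bullet> ?g v + \<mu> / 2 * (norm (u - v))\<^sup>2"
    "h v \<ge> h u + (v - u) \<bullet> ?g u + \<mu> / 2 * (norm (v - u))\<^sup>2"
    using assms by (auto simp: strongly_convex_on_def)
  then have "(u - v) \<bullet> (?g u - ?g v) \<ge> \<mu> * (norm (u - v))\<^sup>2"
    by (simp add: inner_diff norm_minus_commute)
  then have le: "real CARD('n) * (\<mu> * (norm (u - v))\<^sup>2) \<le> real CARD('n) * ((u - v) \<bullet> (?g u - ?g v))"
    by (intro mult_left_mono) auto
  have eq: "vec u - vec v = (vec (u - v) :: (real ^ 'd) ^ 'n)"
    "stack_avg (componentwise g (vec u) - componentwise g (vec v)) = vec (?g u - ?g v)"
    by (simp_all add: stack_avg_simps(2)) (simp_all add: stack_avg_def componentwise_def vec_eq_iff)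
  show ?thesis
    unfolding eq norm_vec_stack inner_vec_stack using le
    by (simp add: sum_constant_scaleR mult.left_commute del: sum_constant)
qed

lemma norm_componentwise_diff_le:
  fixes u v :: "(real ^ 'd) ^ 'n"
  assumes "\<And>i. L-lipschitz_on \<Omega> (g i)" "\<And>i. u $ i \<in> \<Omega>" "\<And>i. v $ i \<in> \<Omega>"
  shows "norm (componentwise g u - componentwise g v) \<le> L * norm (u - v)"
proof (rule norm_stack_mono)
  show "norm ((componentwise g u - componentwise g v) $ i) \<le> L * norm ((u - v) $ i)" for i
    using lipschitz_onD[OF assms(1)[of i] assms(2,3)[of i]] by (simp add: componentwise_def dist_norm)
  show "L \<ge> 0" using assms(1) lipschitz_on_nonneg by blast
qed

text \<open>
  Write \<open>D = stack_avg x - vec x_star\<close> and \<open>U = \<Delta> + e\<close> for the averaged difference of gradients,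
  where \<open>\<Delta>\<close> compares \<open>stack_avg x\<close> with \<open>vec x_star\<close> and \<open>e\<close> is the error of evaluating
  the gradients at the separate \<open>x\<^sub>i\<close>. In the expansion of \<open>(norm (D - \<alpha> *\<^sub>R U))\<^sup>2\<close>, strong
  monotonicity turns \<open>- 2 * \<alpha> * (D \<bullet> \<Delta>)\<close> into \<open>- 2 * \<mu> * \<alpha> * (norm D)\<^sup>2\<close>, and half of this absorbs
  the mixed term with \<open>e\<close>. The last summand of the bound is a crude estimate of
  \<open>\<alpha>\<^sup>2 * (norm U)\<^sup>2\<close> by Lipschitz continuity of all the local gradients.
\<close>

lemma gradient_step_contraction:
  fixes x :: "(real ^ 'd) ^ 'n"
  assumes lip: "\<And>i. L-lipschitz_on \<Omega> (g i)"
    and sc: "\<mu> > 0" "strongly_convex_on \<mu> \<Omega> h (\<lambda>y. average (\<lambda>i. g i y))"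
    and mem: "\<And>i. x $ i \<in> \<Omega>" "convex \<Omega>" "x_star \<in> \<Omega>"
    and \<alpha>: "\<alpha> > 0"
  shows "(norm (stack_avg x - vec x_star - \<alpha> *\<^sub>R stack_avg (componentwise g x - componentwise g (vec x_star))))\<^sup>2
     \<le> (1 - \<mu> * \<alpha>) * (norm (stack_avg x - vec x_star))\<^sup>2
       + \<alpha> * L\<^sup>2 / \<mu> * (norm (x - stack_avg x))\<^sup>2 + \<alpha>\<^sup>2 * (L\<^sup>2 * (norm (x - vec x_star))\<^sup>2)"
proof -
  define D where "D = stack_avg x - vec x_star"
  define U where "U = stack_avg (componentwise g x - componentwise g (vec x_star))"
  define e where "e = stack_avg (componentwise g x - componentwise g (stack_avg x))"
  define \<Delta> where "\<Delta> = stack_avg (componentwise g (stack_avg x) - componentwise g (vec x_star))"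
  have U_eq: "U = \<Delta> + e" by (simp add: U_def \<Delta>_def e_def stack_avg_simps)
  have avg: "average (($) x) \<in> \<Omega>"
    unfolding average_def scaleR_sum_right
    by (rule convex_sum[OF _ mem(2)]) (auto simp: mem)
  have U_le: "norm U \<le> L * norm (x - vec x_star)"
    unfolding U_def
    by (rule order_trans[OF norm_stack_avg_le norm_componentwise_diff_le[OF lip]]) (auto simp: mem)
  have e_le: "norm e \<le> L * norm (x - stack_avg x)"
    unfolding e_def
    by (rule order_trans[OF norm_stack_avg_le norm_componentwise_diff_le[OF lip]])
      (use avg in \<open>auto simp: mem stack_avg_def\<close>)
  have mono: "\<mu> * (norm D)\<^sup>2 \<le> D \<bullet> \<Delta>"
    using strongly_monotone_average[OF sc(2) avg mem(3)] by (simp add: D_def \<Delta>_def stack_avg_def)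
  have "0 \<le> (norm (\<mu> *\<^sub>R D + e))\<^sup>2" by simp
  also have "\<dots> = \<mu>\<^sup>2 * (norm D)\<^sup>2 + 2 * \<mu> * (D \<bullet> e) + (norm e)\<^sup>2"
    by (simp add: power2_norm_eq_inner inner_add inner_commute[of e D]) (simp add: power2_eq_square algebra_simps)
  finally have "0 \<le> (\<mu>\<^sup>2 * (norm D)\<^sup>2 + 2 * \<mu> * (D \<bullet> e) + (norm e)\<^sup>2) / \<mu>"
    using sc(1) by simp
  then have young: "- 2 * (D \<bullet> e) \<le> \<mu> * (norm D)\<^sup>2 + (norm e)\<^sup>2 / \<mu>"
    using sc(1) by (simp add: add_divide_distrib power2_eq_square)
  have "- 2 * (D \<bullet> U) \<le> - \<mu> * (norm D)\<^sup>2 + (norm e)\<^sup>2 / \<mu>"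
    using mono young by (simp add: U_eq inner_add_right)
  also have "(norm e)\<^sup>2 / \<mu> \<le> (L * norm (x - stack_avg x))\<^sup>2 / \<mu>"
    using e_le sc(1) by (intro divide_right_mono power_mono) auto
  finally have cross: "\<alpha> * (- 2 * (D \<bullet> U))
      \<le> \<alpha> * (- \<mu> * (norm D)\<^sup>2 + (L * norm (x - stack_avg x))\<^sup>2 / \<mu>)"
    using \<alpha> by (intro mult_left_mono) auto
  have "(norm (D - \<alpha> *\<^sub>R U))\<^sup>2 = (norm D)\<^sup>2 + \<alpha> * (- 2 * (D \<bullet> U)) + \<alpha>\<^sup>2 * (norm U)\<^sup>2"
    by (simp add: power2_norm_eq_inner inner_diff inner_commute[of U D]) (simp add: power2_eq_square algebra_simps)
  also have "\<dots> \<le> (norm D)\<^sup>2 + \<alpha> * (- \<mu> * (norm D)\<^sup>2 + (L * norm (x - stack_avg x))\<^sup>2 / \<mu>)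
      + \<alpha>\<^sup>2 * (L * norm (x - vec x_star))\<^sup>2"
    by (intro add_mono[OF add_mono[OF order_refl cross]] mult_left_mono power_mono U_le) auto
  also have "\<dots> = (1 - \<mu> * \<alpha>) * (norm D)\<^sup>2
       + \<alpha> * L\<^sup>2 / \<mu> * (norm (x - stack_avg x))\<^sup>2 + \<alpha>\<^sup>2 * (L\<^sup>2 * (norm (x - vec x_star))\<^sup>2)"
    by (simp add: power_mult_distrib algebra_simps)
  finally show ?thesis by (simp add: D_def U_def)
qed

lemma norm_gradients_le:
  fixes x :: "(real ^ 'd) ^ 'n" and g :: "'n \<Rightarrow> real ^ 'd \<Rightarrow> real ^ 'd"
  assumes lip: "\<And>i. L-lipschitz_on \<Omega> (g i)"
    and mem: "\<And>i. x $ i \<in> \<Omega>" "x_star \<in> \<Omega>"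
  shows "(norm (componentwise g x))\<^sup>2
    \<le> 2 * (L\<^sup>2 * (norm (x - vec x_star))\<^sup>2 + real CARD('n) * (MAX i. (norm (g i x_star))\<^sup>2))"
proof -
  have "norm (componentwise g x - componentwise g (vec x_star)) \<le> L * norm (x - vec x_star)"
    by (rule norm_componentwise_diff_le[OF lip]) (auto simp: mem)
  then have 1: "(norm (componentwise g x - componentwise g (vec x_star)))\<^sup>2 \<le> L\<^sup>2 * (norm (x - vec x_star))\<^sup>2"
    using power_mono[of _ _ 2] by (fastforce simp flip: power_mult_distrib)
  have 2: "(norm (componentwise g (vec x_star)))\<^sup>2 \<le> real CARD('n) * (MAX i. (norm (g i x_star))\<^sup>2)"
    unfolding power2_norm_stack by (rule sum_bounded_above) (simp add: componentwise_def)
  have "(norm (componentwise g x))\<^sup>2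
      \<le> (norm (componentwise g x - componentwise g (vec x_star)) + norm (componentwise g (vec x_star)))\<^sup>2"
    by (intro power_mono) (metis diff_add_cancel norm_triangle_ineq, simp)
  also have "\<dots> \<le> 2 * ((norm (componentwise g x - componentwise g (vec x_star)))\<^sup>2 + (norm (componentwise g (vec x_star)))\<^sup>2)"
    using sum_squares_bound[of "norm (componentwise g x - componentwise g (vec x_star))" "norm (componentwise g (vec x_star))"]
    by (simp add: power2_sum)
  also have "\<dots> \<le> 2 * (L\<^sup>2 * (norm (x - vec x_star))\<^sup>2 + real CARD('n) * (MAX i. (norm (g i x_star))\<^sup>2))"
    using 1 2 by (intro mult_left_mono add_mono) auto
  finally show ?thesis .
qed

text \<open>
  Strong convexity at \<open>z = x_star + s *\<^sub>R (y - x_star)\<close> and minimality of \<open>x_star\<close> give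
  \<open>(y - x_star) \<bullet> G z \<ge> 0\<close>, and \<open>s\<close> tending to \<open>0\<close> yields the first order condition
  \<open>(y - x_star) \<bullet> G x_star \<ge> 0\<close> by continuity of \<open>G\<close>. The condition says that \<open>x_star\<close> is the point of \<open>\<Omega>\<close> closest to
  \<open>x_star - \<alpha> *\<^sub>R G x_star\<close>.
\<close>

lemma minimizer_is_projected_gradient_fixpoint:
  assumes sc: "strongly_convex_on \<mu> \<Omega> h G" "\<mu> \<ge> 0"
    and lip: "L-lipschitz_on \<Omega> G"
    and min: "is_arg_min h (\<lambda>y. y \<in> \<Omega>) x_star"
    and \<Omega>: "convex \<Omega>" "closed \<Omega>" and \<alpha>: "\<alpha> \<ge> 0"
  shows "closest_point \<Omega> (x_star - \<alpha> *\<^sub>R G x_star) = x_star"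
proof -
  have xs: "x_star \<in> \<Omega>" and h: "\<And>y. y \<in> \<Omega> \<Longrightarrow> h x_star \<le> h y"
    using min by (auto simp: is_arg_min_linorder)
  have opt: "0 \<le> (y - x_star) \<bullet> G x_star" if y: "y \<in> \<Omega>" for y
  proof (rule field_le_epsilon)
    fix \<epsilon> :: real assume \<epsilon>: "\<epsilon> > 0"
    define w where "w = y - x_star"
    \<comment> \<open>So small that moving by \<open>s *\<^sub>R w\<close> changes \<open>w \<bullet> G\<close> by at most \<open>\<epsilon>\<close>; the summand \<open>1\<close> keeps the
      denominator positive when \<open>w = 0\<close>.\<close>
    define s where "s = min 1 (\<epsilon> / (L * (norm w)\<^sup>2 + 1))"
    have L0: "L \<ge> 0" using lip lipschitz_on_nonneg by blast
    then have den: "L * (norm w)\<^sup>2 + 1 > 0" by (simp add: add_nonneg_pos)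
    have s: "0 < s" "s \<le> 1" using \<epsilon> den by (auto simp: s_def)
    define z where "z = x_star + s *\<^sub>R w"
    have z: "z \<in> \<Omega>"
      using convexD_alt[OF \<Omega>(1) xs y, of s] s by (simp add: z_def w_def algebra_simps)
    have "h x_star \<ge> h z + (x_star - z) \<bullet> G z + \<mu> / 2 * (norm (x_star - z))\<^sup>2"
      using sc(1) xs z by (simp add: strongly_convex_on_def)
    then have "0 \<ge> (x_star - z) \<bullet> G z"
      using h[OF z] sc(2) by (smt (verit) divide_nonneg_nonneg mult_nonneg_nonneg zero_le_power2)
    then have "0 \<le> w \<bullet> G z" using s by (simp add: z_def zero_le_mult_iff)
    also have "\<dots> = w \<bullet> G x_star + w \<bullet> (G z - G x_star)" by (simp add: inner_diff_right)
    also have "w \<bullet> (G z - G x_star) \<le> norm w * norm (G z - G x_star)" by (rule norm_cauchy_schwarz)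
    also have "\<dots> \<le> norm w * (L * (s * norm w))"
      using lipschitz_onD[OF lip z xs] s by (intro mult_left_mono) (auto simp: dist_norm z_def)
    also have "\<dots> = s * (L * (norm w)\<^sup>2)" by (simp add: power2_eq_square)
    also have "\<dots> \<le> s * (L * (norm w)\<^sup>2 + 1)" using s by simp
    also have "\<dots> \<le> \<epsilon> / (L * (norm w)\<^sup>2 + 1) * (L * (norm w)\<^sup>2 + 1)"
      using den by (intro mult_right_mono) (auto simp: s_def)
    also have "\<dots> = \<epsilon>" using den by simp
    finally show "0 \<le> (y - x_star) \<bullet> G x_star + \<epsilon>" by (simp add: w_def)
  qed
  show ?thesis
  proof (rule sym, rule closest_point_unique[OF \<Omega> xs], rule ballI)
    fix y assume y: "y \<in> \<Omega>"
    define p where "p = x_star - \<alpha> *\<^sub>R G x_star"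
    have "0 \<le> \<alpha> * ((y - x_star) \<bullet> G x_star)" using opt[OF y] \<alpha> by simp
    then have "0 \<le> (p - x_star) \<bullet> (x_star - y)"
      by (simp add: p_def inner_diff inner_commute algebra_simps)
    moreover have "(norm (p - y))\<^sup>2
        = (norm (p - x_star))\<^sup>2 + 2 * ((p - x_star) \<bullet> (x_star - y)) + (norm (x_star - y))\<^sup>2"
      by (simp add: power2_norm_eq_inner inner_diff inner_commute)
    ultimately have "(norm (p - x_star))\<^sup>2 \<le> (norm (p - y))\<^sup>2" by simp
    then show "dist (x_star - \<alpha> *\<^sub>R G x_star) x_star \<le> dist (x_star - \<alpha> *\<^sub>R G x_star) y"
      by (simp add: p_def dist_norm)
  qed
qed

section \<open>The projected iteration\<close>

lemma norm_closest_point_stack_le: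
  fixes u v :: "(real ^ 'd) ^ 'n"
  assumes "closed \<Omega>" "convex \<Omega>" "\<Omega> \<noteq> {}"
  shows "norm (componentwise (\<lambda>_. closest_point \<Omega>) u - componentwise (\<lambda>_. closest_point \<Omega>) v)
    \<le> norm (u - v)"
proof -
  have "norm (closest_point \<Omega> (u $ i) - closest_point \<Omega> (v $ i)) \<le> 1 * norm (u $ i - v $ i)" for i
    using closest_point_lipschitz[OF assms(2,1,3), of "u $ i" "v $ i"] by (simp add: dist_norm)
  then show ?thesis
    using norm_stack_mono[of "componentwise (\<lambda>_. closest_point \<Omega>) u
        - componentwise (\<lambda>_. closest_point \<Omega>) v" 1 "u - v"]
    by (simp add: componentwise_def)
qed

text \<open>
  Projecting componentwise is nonexpansive and maps \<open>vec c\<close> to \<open>vec (closest_point \<Omega> c)\<close>. For the first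
  bound \<open>c\<close> is the average of \<open>y\<close>: the spread of \<open>x'\<close> around its own average is at most
  its spread around any other point. For the second one \<open>c = z\<close>, and Pythagoras splits the distance of
  \<open>y\<close> from \<open>vec z\<close>.
\<close>

lemma projected_step_le:
  fixes y :: "(real ^ 'd) ^ 'n"
  assumes \<Omega>: "closed \<Omega>" "convex \<Omega>" "\<Omega> \<noteq> {}"
  defines "x' \<equiv> componentwise (\<lambda>_. closest_point \<Omega>) y"
  shows "(norm (x' - stack_avg x'))\<^sup>2 \<le> (norm (y - stack_avg y))\<^sup>2"
    and "(norm (stack_avg x' - vec (closest_point \<Omega> z)))\<^sup>2
      \<le> (norm (stack_avg y - vec z))\<^sup>2 + (norm (y - stack_avg y))\<^sup>2"
proof -
  have nonexpansive: "(norm (x' - vec (closest_point \<Omega> c)))\<^sup>2 \<le> (norm (y - vec c))\<^sup>2" for c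
  proof -
    have "componentwise (\<lambda>_. closest_point \<Omega>) (vec c) = (vec (closest_point \<Omega> c) :: (real ^ 'd) ^ 'n)"
      by (simp add: componentwise_def vec_eq_iff)
    then show ?thesis
      using norm_closest_point_stack_le[OF \<Omega>, of y "vec c"] by (simp add: x'_def power_mono)
  qed
  define c where "c = average (($) y)"
  have c: "stack_avg y = vec c" by (simp add: c_def stack_avg_def)
  have "(norm (x' - stack_avg x'))\<^sup>2 \<le> (norm (x' - vec (closest_point \<Omega> c)))\<^sup>2"
    using norm_minus_vec_stack[of x' "closest_point \<Omega> c"] by simp
  also have "\<dots> \<le> (norm (y - stack_avg y))\<^sup>2"
    unfolding c by (rule nonexpansive)
  finally show "(norm (x' - stack_avg x'))\<^sup>2 \<le> (norm (y - stack_avg y))\<^sup>2" .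
  have "(norm (stack_avg x' - vec (closest_point \<Omega> z)))\<^sup>2 \<le> (norm (x' - vec (closest_point \<Omega> z)))\<^sup>2"
    using norm_minus_vec_stack[of x' "closest_point \<Omega> z"] by simp
  also have "\<dots> \<le> (norm (y - vec z))\<^sup>2" by (rule nonexpansive)
  also have "\<dots> = (norm (stack_avg y - vec z))\<^sup>2 + (norm (y - stack_avg y))\<^sup>2"
    by (simp add: norm_minus_vec_stack[of y z])
  finally show "(norm (stack_avg x' - vec (closest_point \<Omega> z)))\<^sup>2
      \<le> (norm (stack_avg y - vec z))\<^sup>2 + (norm (y - stack_avg y))\<^sup>2" .
qed

lemma lipschitz_on_average:
  fixes g :: "'n::finite \<Rightarrow> 'a::metric_space \<Rightarrow> 'b::real_normed_vector"
  assumes "\<And>i. L-lipschitz_on \<Omega> (g i)"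
  shows "L-lipschitz_on \<Omega> (\<lambda>y. average (\<lambda>i. g i y))"
proof (rule lipschitz_onI)
  show "L \<ge> 0" using assms lipschitz_on_nonneg by blast
  fix u v assume uv: "u \<in> \<Omega>" "v \<in> \<Omega>"
  have "norm (\<Sum>i\<in>UNIV. g i u - g i v) \<le> (\<Sum>i\<in>(UNIV :: 'n set). L * dist u v)"
    by (rule sum_norm_le) (use lipschitz_onD[OF assms uv] in \<open>simp add: dist_norm\<close>)
  then show "dist (average (\<lambda>i. g i u)) (average (\<lambda>i. g i v)) \<le> L * dist u v"
    unfolding dist_norm[of "average _"] average_simps(2)[symmetric]
    by (simp add: average_def field_simps)
qed

theorem theorem2p8:
  fixes \<Omega> :: "(real ^ 'd) set"
    and f :: "'n::finite \<Rightarrow> real ^ 'd \<Rightarrow> real"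
    and g :: "'n \<Rightarrow> real ^ 'd \<Rightarrow> real ^ 'd"
    and E :: "'n set set"
    and W :: "real ^ 'n ^ 'n"
    and x :: "nat \<Rightarrow> (real ^ 'd) ^ 'n"
    and x_star :: "real ^ 'd"
    and L \<mu> \<alpha> R_s :: real
  assumes "\<Omega> \<noteq> {}" "closed \<Omega>" "convex \<Omega>"
    and gradient: "\<And>i. gradient_on \<Omega> (f i) (g i)"
    and smooth: "L > 0" "\<And>i. L-lipschitz_on \<Omega> (g i)"
    and strongly_convex: "\<mu> > 0"
      "strongly_convex_on \<mu> \<Omega> (\<lambda>y. average (\<lambda>i. f i y)) (\<lambda>y. average (\<lambda>i. g i y))"
    and minimizer: "is_arg_min (\<lambda>y. average (\<lambda>i. f i y)) (\<lambda>y. y \<in> \<Omega>) x_star"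
    and network: "connected_graph E" "mixing_matrix E W"
    and stepsize: "\<alpha> > 0" "\<alpha> \<le> 2 / (L + \<mu>)"
    and iterates: "dpg_iterates \<Omega> W g (\<lambda>_. \<alpha>) x"
    and bounded: "R_s > 0" "\<And>t. (norm (x t - vec x_star))\<^sup>2 \<le> R_s"
  shows
    "let n = real CARD('n);
         \<beta> = second_eigenvalue_magnitude W;
         R_D = (MAX i. (norm (g i x_star))\<^sup>2);
         c1 = 3 * L\<^sup>2 / (1 - \<beta>);
         c2 = 3 * n * R_D / (1 - \<beta>);
         c3 = c1 + L\<^sup>2;
         c4 = 4 * L\<^sup>2 / \<mu>;
         G1 = 2 * (c3 * \<alpha>\<^sup>2 + c4 * \<alpha> + \<beta>) * R_s / (\<mu> * \<alpha>);
         G2 = 2 / \<mu> * ((c3 * \<alpha>\<^sup>2 + c4 * \<alpha> + \<beta>) * (3 * (L\<^sup>2 * R_s + n * R_D) / (1 - \<beta>)\<^sup>2)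
                        + c1 * R_s + c2)
     in \<forall>t\<ge>1. (norm (stack_avg (x t) - vec x_star))\<^sup>2
              \<le> (1 - \<mu> * \<alpha> / 2) ^ t * (norm (stack_avg (x 0) - vec x_star))\<^sup>2
                + G1 * ((1 - \<mu> * \<alpha> / 2) ^ (t - 1) + sqrt \<beta> ^ (t - 1)) + G2 * \<alpha>"
proof -
  define n where "n = real CARD('n)"
  define \<beta> where "\<beta> = second_eigenvalue_magnitude W"
  define R_D where "R_D = (MAX i. (norm (g i x_star))\<^sup>2)"
  define c1 where "c1 = 3 * L\<^sup>2 / (1 - \<beta>)"
  define c2 where "c2 = 3 * n * R_D / (1 - \<beta>)"
  define K where "K = (c1 + L\<^sup>2) * \<alpha>\<^sup>2 + 4 * L\<^sup>2 / \<mu> * \<alpha> + \<beta>"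
  define H where "H = L\<^sup>2 * R_s + n * R_D"
  define a where "a t = (norm (stack_avg (x t) - vec x_star))\<^sup>2" for t
  define b where "b t = (norm (x t - stack_avg (x t)))\<^sup>2" for t
  define r where "r = 1 - \<mu> * \<alpha> / 2"
  let ?G = "\<lambda>t. componentwise g (x t)"
  let ?y = "\<lambda>t. mix W (x t) - \<alpha> *\<^sub>R ?G t"
  let ?z = "x_star - \<alpha> *\<^sub>R average (\<lambda>i. g i x_star)"

  note \<Omega> = \<open>closed \<Omega>\<close> \<open>convex \<Omega>\<close> \<open>\<Omega> \<noteq> {}\<close>
  note \<beta> = second_eigenvalue_magnitude_bounds[OF network(2), folded \<beta>_def]
  have xs: "x_star \<in> \<Omega>" using minimizer by (simp add: is_arg_min_def)
  have mem: "x t $ i \<in> \<Omega>" for t i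
    using iterates \<Omega> by (cases t) (auto simp: dpg_iterates_def closest_point_in_set)
  have x_Suc: "x (Suc t) = componentwise (\<lambda>_. closest_point \<Omega>) (?y t)" for t
    using iterates by (simp add: dpg_iterates_def componentwise_def mix_def vec_eq_iff)
  have z: "closest_point \<Omega> ?z = x_star"
    using minimizer_is_projected_gradient_fixpoint[OF strongly_convex(2) _
        lipschitz_on_average[OF smooth(2)] minimizer \<Omega>(2,1)]
      strongly_convex(1) stepsize(1) by simp

  have R_D: "R_D \<ge> 0"
  proof -
    have "(norm (g i x_star))\<^sup>2 \<le> R_D" for i by (simp add: R_D_def)
    then show ?thesis using zero_le_power2 order_trans by blast
  qed
  then have H: "H \<ge> 0" using bounded(1) by (simp add: H_def n_def)
  have "0 \<le> c1" "0 \<le> c2" using \<beta> R_D by (simp_all add: c1_def c2_def n_def)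
  then have K: "K \<ge> 0" and D: "c1 * R_s + c2 \<ge> 0"
    using stepsize(1) strongly_convex(1) \<beta> bounded(1) by (simp_all add: K_def)
  have r: "0 < r" "r < 1"
  proof -
    have "\<alpha> * (L + \<mu>) \<le> 2"
      using stepsize(2) smooth(1) strongly_convex(1) by (simp add: field_simps)
    moreover have "\<alpha> * L > 0" "\<alpha> * \<mu> > 0" using stepsize(1) smooth(1) strongly_convex(1) by auto
    ultimately show "0 < r" "r < 1" by (auto simp: r_def algebra_simps)
  qed

  have ab: "(norm (x t - vec x_star))\<^sup>2 = b t + a t" for t
    by (simp add: a_def b_def norm_minus_vec_stack[of "x t" x_star])
  have b_le: "b t \<le> R_s" for t
    using bounded(2)[of t] zero_le_power2[of "norm (stack_avg (x t) - vec x_star)"]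
    unfolding ab a_def by linarith
  have G_le: "(norm (?G t))\<^sup>2 \<le> 2 * H" for t
  proof -
    have "(norm (?G t))\<^sup>2 \<le> 2 * (L\<^sup>2 * (norm (x t - vec x_star))\<^sup>2 + n * R_D)"
      unfolding n_def R_D_def by (rule norm_gradients_le[OF smooth(2) mem xs])
    also have "\<dots> \<le> 2 * H"
      unfolding H_def by (intro mult_left_mono add_mono bounded(2)) (auto simp: n_def)
    finally show ?thesis .
  qed
  have spread: "(norm (?y t - stack_avg (?y t)))\<^sup>2 \<le> \<beta> * b t + \<alpha>\<^sup>2 * (2 * H / (1 - \<beta>))" for t
  proof -
    have "\<alpha>\<^sup>2 * (norm (?G t))\<^sup>2 / (1 - \<beta>) \<le> \<alpha>\<^sup>2 * (2 * H) / (1 - \<beta>)"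
      using G_le \<beta> by (intro divide_right_mono mult_left_mono) auto
    then show ?thesis
      using disagreement_after_step_le[OF network(2), of \<alpha> "x t" "?G t"] stepsize(1)
      by (simp add: \<beta>_def b_def)
  qed
  have b_Suc: "b (Suc t) \<le> \<beta> * b t + \<alpha>\<^sup>2 * (3 * H / (1 - \<beta>))" for t
  proof -
    have "b (Suc t) \<le> \<beta> * b t + \<alpha>\<^sup>2 * (2 * H / (1 - \<beta>))"
      using order_trans[OF projected_step_le(1)[OF \<Omega>] spread] by (simp add: b_def x_Suc)
    also have "\<dots> \<le> \<beta> * b t + \<alpha>\<^sup>2 * (3 * H / (1 - \<beta>))"
      using H \<beta> by (intro add_left_mono mult_left_mono divide_right_mono) auto
    finally show ?thesis .
  qed
  \<comment> \<open>Twice \<open>H\<close> over \<open>1 - \<beta>\<close> comes from the spread; a third copy pays for the second order term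
    \<open>L\<^sup>2 * R_s\<close> of the gradient step. This is the factor \<open>3\<close> in \<open>c1\<close> and \<open>c2\<close>.\<close>
  have a_Suc: "a (Suc t) \<le> r * a t + K * b t + \<alpha>\<^sup>2 * (c1 * R_s + c2)" for t
  proof -
    have avg: "stack_avg (?y t) - vec ?z
        = stack_avg (x t) - vec x_star - \<alpha> *\<^sub>R stack_avg (?G t - componentwise g (vec x_star))"
      unfolding stack_avg_simps stack_avg_mix[OF network(2)]
      by (simp add: stack_avg_def componentwise_def vec_eq_iff algebra_simps)
    have "(norm (stack_avg (?y t) - vec ?z))\<^sup>2
        \<le> (1 - \<mu> * \<alpha>) * a t + \<alpha> * L\<^sup>2 / \<mu> * b t + \<alpha>\<^sup>2 * (L\<^sup>2 * (norm (x t - vec x_star))\<^sup>2)"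
      unfolding avg a_def b_def
      by (rule gradient_step_contraction[OF smooth(2) strongly_convex mem \<Omega>(2) xs stepsize(1)])
    also have "\<dots> \<le> r * a t + \<alpha> * L\<^sup>2 / \<mu> * b t + \<alpha>\<^sup>2 * (L\<^sup>2 * R_s)"
      using strongly_convex(1) stepsize(1)
      by (intro add_mono mult_left_mono mult_right_mono bounded(2)) (auto simp: r_def a_def)
    finally have step: "(norm (stack_avg (?y t) - vec ?z))\<^sup>2
        \<le> r * a t + \<alpha> * L\<^sup>2 / \<mu> * b t + \<alpha>\<^sup>2 * (L\<^sup>2 * R_s)" .
    have "a (Suc t) \<le> (norm (stack_avg (?y t) - vec ?z))\<^sup>2 + (norm (?y t - stack_avg (?y t)))\<^sup>2"
      using projected_step_le(2)[OF \<Omega>, of "?y t" ?z] unfolding z a_def x_Suc .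
    also have "\<dots> \<le> r * a t + (\<alpha> * L\<^sup>2 / \<mu> + \<beta>) * b t + \<alpha>\<^sup>2 * (L\<^sup>2 * R_s + 2 * H / (1 - \<beta>))"
      using step spread[of t] by (simp add: algebra_simps)
    also have "\<dots> \<le> r * a t + K * b t + \<alpha>\<^sup>2 * (c1 * R_s + c2)"
    proof (rule add_mono[OF add_mono[OF order_refl mult_right_mono] mult_left_mono])
      have "\<alpha> * L\<^sup>2 / \<mu> \<le> 4 * L\<^sup>2 / \<mu> * \<alpha>"
        using strongly_convex(1) stepsize(1) by (simp add: field_simps)
      then show "\<alpha> * L\<^sup>2 / \<mu> + \<beta> \<le> K"
        using \<open>0 \<le> c1\<close> by (simp add: K_def add_increasing)
      have "L\<^sup>2 * R_s \<le> H / (1 - \<beta>)"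
      proof -
        have "L\<^sup>2 * R_s \<le> H" using R_D by (simp add: H_def n_def)
        also have "\<dots> \<le> H / (1 - \<beta>)"
          using H \<beta> by (simp add: field_simps)
        finally show ?thesis .
      qed
      moreover have "H / (1 - \<beta>) + 2 * H / (1 - \<beta>) = c1 * R_s + c2"
        by (simp add: c1_def c2_def H_def flip: add_divide_distrib)
      ultimately show "L\<^sup>2 * R_s + 2 * H / (1 - \<beta>) \<le> c1 * R_s + c2" by linarith
    qed (auto simp: b_def)
    finally show ?thesis .
  qed

  have main: "a t \<le> r ^ t * a 0 + 2 * K * R_s / (\<mu> * \<alpha>) * (r ^ (t - 1) + sqrt \<beta> ^ (t - 1))
      + 2 / \<mu> * (K * (3 * H / (1 - \<beta>)\<^sup>2) + c1 * R_s + c2) * \<alpha>" if "t \<ge> 1" for t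
  proof -
    obtain m where t: "t = Suc m" using \<open>t \<ge> 1\<close> by (cases t) auto
    have "a (Suc m) \<le> r ^ Suc m * a 0 + K * b 0 * ((r ^ m + sqrt \<beta> ^ m) / (1 - r))
        + (K * (\<alpha>\<^sup>2 * (3 * H / (1 - \<beta>)) / (1 - \<beta>)) + \<alpha>\<^sup>2 * (c1 * R_s + c2)) / (1 - r)"
    proof (rule coupled_recursion_bound[where a = a and b = b, OF a_Suc b_Suc r \<beta> K])
      show "b 0 \<ge> 0" by (simp add: b_def)
      show "\<alpha>\<^sup>2 * (3 * H / (1 - \<beta>)) \<ge> 0" using H \<beta> by simp
      show "\<alpha>\<^sup>2 * (c1 * R_s + c2) \<ge> 0" using D by simp
    qed
    also have "K * b 0 * ((r ^ m + sqrt \<beta> ^ m) / (1 - r))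
        \<le> K * R_s * ((r ^ m + sqrt \<beta> ^ m) / (1 - r))"
      using K b_le r \<beta> by (intro mult_right_mono mult_left_mono) auto
    also have "\<dots> = 2 * K * R_s / (\<mu> * \<alpha>) * (r ^ m + sqrt \<beta> ^ m)"
      by (simp add: r_def)
    also have "(K * (\<alpha>\<^sup>2 * (3 * H / (1 - \<beta>)) / (1 - \<beta>)) + \<alpha>\<^sup>2 * (c1 * R_s + c2)) / (1 - r)
        = 2 / \<mu> * (K * (3 * H / (1 - \<beta>)\<^sup>2) + c1 * R_s + c2) * \<alpha>"
    proof -
      have "K * (\<alpha>\<^sup>2 * (3 * H / (1 - \<beta>)) / (1 - \<beta>)) + \<alpha>\<^sup>2 * (c1 * R_s + c2)
          = \<alpha>\<^sup>2 * (K * (3 * H / (1 - \<beta>)\<^sup>2) + c1 * R_s + c2)"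
        by (simp add: power2_eq_square distrib_left)
      moreover have "\<alpha>\<^sup>2 * C / (1 - r) = 2 / \<mu> * C * \<alpha>" for C
        using stepsize(1) by (simp add: r_def power2_eq_square)
      ultimately show ?thesis by simp
    qed
    finally show ?thesis by (simp add: t)
  qed
  show ?thesis
    using main
    unfolding Let_def n_def \<beta>_def R_D_def c1_def c2_def K_def H_def a_def r_def by blast
qed

end
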